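(* Let $N_0>0$, $D_0>0$ with $N_0\ge D_0$, and $0<S_0\le S_{max}$. Suppose the whole debt is repaid by an instantaneous payment at time $0$, so that problem $(P)$ of the context is considered with initial state $N(0)=N_0-D_0$, $D(0)=0$, $S(0)=S_0$. Put $t_S=\frac1\alpha\ln\frac{\alpha S_0+w_{max}}{w_{max}}$ and assume $t_S<T$. Then the control $$u^*(t)=\begin{cases}0,& t\in[0,t_S)\\ w_{max},& t\in[t_S,T]\end{cases},\qquad v^*(t)=\begin{cases}0,& t\in[0,t_S)\\ A w_{max},& t\in[t_S,T]\end{cases},\qquad w^*(t)\equiv w_{max}$$ is optimal for this problem, and $$\mathcal J(u^*,v^*,w^* )=N_0-D_0+(p w_{max}-B)T+(A+K)w_{max}(t_S-T)>0.$$
   Context: Problem $(P)$: given constants $T,p,r,A,K,B,\alpha,u_{max},v_{max},w_{max},S_{max}>0$ and a prescribed initial state $(N(0),D(0),S(0))$, maximize $$\mathcal J(u,v,w)=N(T)-D(T)$$ over piecewise continuous controls $(u,v,w)$ on $[0,T]$ with $0\le u(t)\le u_{max}$, $0\le v(t)\le v_{max}$, $0\le w(t)\le w_{max}$, subject to $$\dot N=p w-v-Ku-B,\qquad \dot D=rD+Au-v,\qquad \dot S=u-w-\alpha S,$$ and to the state constraints $N(t)\ge0$, $D(t)\ge0$, $0\le S(t)\le S_{max}$ for all $t\in[0,T]$. A control is optimal if it is admissible (satisfies all the constraints) and attains the maximum of $\mathcal J$ over all admissible controls. Standing assumptions: $w_{max}\le u_{max}$; $v_{max}\ge A w_{max}$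 (the maximal repayment rate is large); and the firm is profitable, i.e. $p w>Ku+B+Au$ along the strategy considered, which for $u=w=w_{max}$ reads $(p-A-K)w_{max}>B$. *)

theory Defs
  imports "HOL-Analysis.Analysis"
begin

definition piecewise_continuous_on :: "real \<Rightarrow> real \<Rightarrow> (real \<Rightarrow> real) \<Rightarrow> bool" where
  "piecewise_continuous_on a b f \<longleftrightarrow>
     finite {t \<in> {a..b}. \<not> continuous (at t within {a..b}) f} \<and>
     (\<forall>t \<in> {a<..b}. \<exists>l. (f \<longlongrightarrow> l) (at_left t)) \<and>
     (\<forall>t \<in> {a..<b}. \<exists>l. (f \<longlongrightarrow> l) (at_right t))"

text \<open>The controls may jump, so the state is a continuous solution of the initial value problem
  that satisfies the differential equations off a finite set of times. The values of controls and
  states outside \<open>[0, T]\<close> play no role.\<close>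

definition state_trajectory ::
  "real \<Rightarrow> real \<Rightarrow> real \<Rightarrow> real \<Rightarrow> real \<Rightarrow> real \<Rightarrow> real \<Rightarrow>
   real \<Rightarrow> real \<Rightarrow> real \<Rightarrow>
   (real \<Rightarrow> real) \<Rightarrow> (real \<Rightarrow> real) \<Rightarrow> (real \<Rightarrow> real) \<Rightarrow>
   (real \<Rightarrow> real) \<Rightarrow> (real \<Rightarrow> real) \<Rightarrow> (real \<Rightarrow> real) \<Rightarrow> bool" where
  "state_trajectory T p r A K B \<alpha> N\<^sub>0 D\<^sub>0 S\<^sub>0 u v w N D S \<longleftrightarrow>
     continuous_on {0..T} N \<and> continuous_on {0..T} D \<and> continuous_on {0..T} S \<and>
     N 0 = N\<^sub>0 \<and> D 0 = D\<^sub>0 \<and> S 0 = S\<^sub>0 \<and>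
     (\<exists>F. finite F \<and> (\<forall>t \<in> {0..T} - F.
        (N has_real_derivative p * w t - v t - K * u t - B) (at t within {0..T}) \<and>
        (D has_real_derivative r * D t + A * u t - v t) (at t within {0..T}) \<and>
        (S has_real_derivative u t - w t - \<alpha> * S t) (at t within {0..T})))"

definition admissible_control ::
  "real \<Rightarrow> real \<Rightarrow> real \<Rightarrow> real \<Rightarrow> real \<Rightarrow> real \<Rightarrow> real \<Rightarrow>
   real \<Rightarrow> real \<Rightarrow> real \<Rightarrow> real \<Rightarrow>
   real \<Rightarrow> real \<Rightarrow> real \<Rightarrow>
   (real \<Rightarrow> real) \<Rightarrow> (real \<Rightarrow> real) \<Rightarrow> (real \<Rightarrow> real) \<Rightarrow> bool" where
  "admissible_control T p r A K B \<alpha> u_max v_max w_max S_max N\<^sub>0 D\<^sub>0 S\<^sub>0 u v w \<longleftrightarrow>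
     piecewise_continuous_on 0 T u \<and>
     piecewise_continuous_on 0 T v \<and>
     piecewise_continuous_on 0 T w \<and>
     (\<forall>t \<in> {0..T}. 0 \<le> u t \<and> u t \<le> u_max \<and>
                   0 \<le> v t \<and> v t \<le> v_max \<and>
                   0 \<le> w t \<and> w t \<le> w_max) \<and>
     (\<exists>N D S. state_trajectory T p r A K B \<alpha> N\<^sub>0 D\<^sub>0 S\<^sub>0 u v w N D S \<and>
        (\<forall>t \<in> {0..T}. N t \<ge> 0 \<and> D t \<ge> 0 \<and> 0 \<le> S t \<and> S t \<le> S_max))"

text \<open>The terminal value \<open>N(T) - D(T)\<close> is determined by the controls, since the initial value
  problem has only one solution on \<open>[0, T]\<close>; the description operator selects that value.\<close>

definition objective ::
  "real \<Rightarrow> real \<Rightarrow> real \<Rightarrow> real \<Rightarrow> real \<Rightarrow> real \<Rightarrow> real \<Rightarrow>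
   real \<Rightarrow> real \<Rightarrow> real \<Rightarrow>
   (real \<Rightarrow> real) \<Rightarrow> (real \<Rightarrow> real) \<Rightarrow> (real \<Rightarrow> real) \<Rightarrow> real" where
  "objective T p r A K B \<alpha> N\<^sub>0 D\<^sub>0 S\<^sub>0 u v w =
     (THE j. \<exists>N D S. state_trajectory T p r A K B \<alpha> N\<^sub>0 D\<^sub>0 S\<^sub>0 u v w N D S \<and> j = N T - D T)"

definition optimal_control ::
  "real \<Rightarrow> real \<Rightarrow> real \<Rightarrow> real \<Rightarrow> real \<Rightarrow> real \<Rightarrow> real \<Rightarrow>
   real \<Rightarrow> real \<Rightarrow> real \<Rightarrow> real \<Rightarrow>
   real \<Rightarrow> real \<Rightarrow> real \<Rightarrow>
   (real \<Rightarrow> real) \<Rightarrow> (real \<Rightarrow> real) \<Rightarrow> (real \<Rightarrow> real) \<Rightarrow> bool" where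
  "optimal_control T p r A K B \<alpha> u_max v_max w_max S_max N\<^sub>0 D\<^sub>0 S\<^sub>0 u v w \<longleftrightarrow>
     admissible_control T p r A K B \<alpha> u_max v_max w_max S_max N\<^sub>0 D\<^sub>0 S\<^sub>0 u v w \<and>
     (\<forall>u' v' w'.
        admissible_control T p r A K B \<alpha> u_max v_max w_max S_max N\<^sub>0 D\<^sub>0 S\<^sub>0 u' v' w' \<longrightarrow>
        objective T p r A K B \<alpha> N\<^sub>0 D\<^sub>0 S\<^sub>0 u' v' w' \<le> objective T p r A K B \<alpha> N\<^sub>0 D\<^sub>0 S\<^sub>0 u v w)"

end

theory Submission imports Defs begin

text \<open>The optimal state has \<open>D* = 0\<close> and follows \<open>S*\<close>, the fastest possible depletion of the stock,
  so every admissible stock satisfies \<open>S \<ge> S*\<close>. Along any admissible state the quantity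
  \<open>(N - D - N*) + (K + A) (S - S*)\<close> has derivative
  \<open>(p - K - A) (w - w_max) - r D - (K + A) \<alpha> (S - S*) \<le> 0\<close>: adding the multiple of \<open>S\<close> eliminates the
  control \<open>u\<close>. Since it starts at \<open>0\<close> and \<open>S*(T) = 0\<close>, this gives \<open>N(T) - D(T) \<le> N*(T)\<close>.\<close>

section \<open>Monotonicity from derivatives off a finite set\<close>

text \<open>States are differentiable only off finitely many times, so the fundamental theorem of
  calculus with a finite exceptional set is used: the increment of \<open>f\<close> is the integral
  of \<open>f'\<close>, set to zero at exceptional points.\<close>

lemma increasing_if_derivative_nonneg_off_finite:
  fixes f f' :: "real \<Rightarrow> real"
  assumes "a \<le> b" "finite F" "continuous_on {a..b} f"
    and deriv: "\<And>t. t \<in> {a<..<b} - F \<Longrightarrow> (f has_real_derivative f' t) (at t)"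
    and nonneg: "\<And>t. t \<in> {a<..<b} - F \<Longrightarrow> 0 \<le> f' t"
  shows "f a \<le> f b"
proof -
  define g where "g t = (if t \<in> {a<..<b} - F then f' t else 0)" for t
  have "(g has_integral (f b - f a)) {a..b}"
  proof (rule fundamental_theorem_of_calculus_interior_strong[OF \<open>finite F\<close> \<open>a \<le> b\<close>])
    fix t assume "t \<in> {a<..<b} - F"
    then show "(f has_vector_derivative g t) (at t)"
      using deriv[of t] by (simp add: g_def has_real_derivative_iff_has_vector_derivative)
  qed fact
  moreover have "0 \<le> g t" for t
    using nonneg by (simp add: g_def)
  ultimately have "0 \<le> f b - f a"
    using has_integral_nonneg by blast
  then show ?thesis by simp
qed

text \<open>At interior points the derivative within \<open>{0..T}\<close> is the full derivative,
  the form that the monotonicity lemma asks for; one set \<open>F\<close> serves all three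
  equations.\<close>

lemma state_trajectory_derivatives:
  assumes "state_trajectory T p r A K B \<alpha> N\<^sub>0 D\<^sub>0 S\<^sub>0 u v w N D S"
  obtains F where "finite F"
    and "\<And>t. t \<in> {0<..<T} - F \<Longrightarrow> (N has_real_derivative p * w t - v t - K * u t - B) (at t)"
    and "\<And>t. t \<in> {0<..<T} - F \<Longrightarrow> (D has_real_derivative r * D t + A * u t - v t) (at t)"
    and "\<And>t. t \<in> {0<..<T} - F \<Longrightarrow> (S has_real_derivative u t - w t - \<alpha> * S t) (at t)"
proof -
  obtain F where F: "finite F" "\<And>t. t \<in> {0..T} - F \<Longrightarrow>
        (N has_real_derivative p * w t - v t - K * u t - B) (at t within {0..T}) \<and>
        (D has_real_derivative r * D t + A * u t - v t) (at t within {0..T}) \<and>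
        (S has_real_derivative u t - w t - \<alpha> * S t) (at t within {0..T})"
    using assms unfolding state_trajectory_def by blast
  have "at t within {0..T} = at t" if "t \<in> {0<..<T} - F" for t
    using that by (simp add: at_within_Icc_at)
  then show thesis
    using F(2) by (intro that[OF F(1)]) (metis DiffE DiffI greaterThanLessThan_subseteq_atLeastAtMost_iff order_refl subsetD)+
qed

section \<open>Uniqueness of terminal debt and cash\<close>

text \<open>The difference of two debts under the same controls solves y' = r y and starts at 0, so
  multiplying it by \<open>exp (- r * t)\<close> gives derivative zero. Exchanging the two
  trajectories yields the reverse inequality, hence uniqueness.\<close>

lemma state_trajectory_debt_le:
  assumes "0 \<le> T"
    and st1: "state_trajectory T p r A K B \<alpha> N\<^sub>0 D\<^sub>0 S\<^sub>0 u v w N D S"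
    and st2: "state_trajectory T p r A K B \<alpha> N\<^sub>0 D\<^sub>0 S\<^sub>0 u v w N' D' S'"
  shows "D T \<le> D' T"
proof -
  obtain F where F: "finite F"
    and dD: "\<And>t. t \<in> {0<..<T} - F \<Longrightarrow> (D has_real_derivative r * D t + A * u t - v t) (at t)"
    by (rule state_trajectory_derivatives[OF st1]) (erule that; simp)
  obtain F' where F': "finite F'"
    and dD': "\<And>t. t \<in> {0<..<T} - F' \<Longrightarrow> (D' has_real_derivative r * D' t + A * u t - v t) (at t)"
    by (rule state_trajectory_derivatives[OF st2]) (erule that; simp)
  define g where "g t = exp (- r * t) * (D' t - D t)" for t
  have "g 0 \<le> g T"
  proof (rule increasing_if_derivative_nonneg_off_finite[where f = g and F = "F \<union> F'" and f' = "\<lambda>_. 0"])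
    show "continuous_on {0..T} g"
      unfolding g_def using st1 st2 by (auto simp: state_trajectory_def intro!: continuous_intros)
    show "(g has_real_derivative 0) (at t)" if "t \<in> {0<..<T} - (F \<union> F')" for t
      unfolding g_def using that
      by (auto intro!: derivative_eq_intros dD dD' simp: algebra_simps)
  qed (use F F' \<open>0 \<le> T\<close> in auto)
  moreover have "g 0 = 0"
    using st1 st2 by (simp add: g_def state_trajectory_def)
  ultimately show ?thesis
    by (simp add: g_def zero_le_mult_iff)
qed

lemma state_trajectory_cash_le:
  assumes "0 \<le> T"
    and st1: "state_trajectory T p r A K B \<alpha> N\<^sub>0 D\<^sub>0 S\<^sub>0 u v w N D S"
    and st2: "state_trajectory T p r A K B \<alpha> N\<^sub>0 D\<^sub>0 S\<^sub>0 u v w N' D' S'"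
  shows "N T \<le> N' T"
proof -
  obtain F where F: "finite F"
    and dN: "\<And>t. t \<in> {0<..<T} - F \<Longrightarrow> (N has_real_derivative p * w t - v t - K * u t - B) (at t)"
    by (rule state_trajectory_derivatives[OF st1]) (erule that; simp)
  obtain F' where F': "finite F'"
    and dN': "\<And>t. t \<in> {0<..<T} - F' \<Longrightarrow> (N' has_real_derivative p * w t - v t - K * u t - B) (at t)"
    by (rule state_trajectory_derivatives[OF st2]) (erule that; simp)
  define g where "g t = N' t - N t" for t
  have "g 0 \<le> g T"
  proof (rule increasing_if_derivative_nonneg_off_finite[where f = g and F = "F \<union> F'" and f' = "\<lambda>_. 0"])
    show "continuous_on {0..T} g"
      unfolding g_def using st1 st2 by (auto simp: state_trajectory_def intro!: continuous_intros)
    show "(g has_real_derivative 0) (at t)" if "t \<in> {0<..<T} - (F \<union> F')" for t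
      unfolding g_def using that by (auto intro!: derivative_eq_intros dN dN')
  qed (use F F' \<open>0 \<le> T\<close> in auto)
  moreover have "g 0 = 0"
    using st1 st2 by (simp add: g_def state_trajectory_def)
  ultimately show ?thesis
    by (simp add: g_def)
qed

text \<open>The description in \<open>objective\<close> is well-defined: the cash and debt
  comparisons, each used in both directions, make any two trajectories agree at
  \<open>T\<close>.\<close>

lemma objective_eq:
  assumes "0 \<le> T" and st: "state_trajectory T p r A K B \<alpha> N\<^sub>0 D\<^sub>0 S\<^sub>0 u v w N D S"
  shows "objective T p r A K B \<alpha> N\<^sub>0 D\<^sub>0 S\<^sub>0 u v w = N T - D T"
  unfolding objective_def
proof (rule the_equality)
  fix j
  assume "\<exists>N D S. state_trajectory T p r A K B \<alpha> N\<^sub>0 D\<^sub>0 S\<^sub>0 u v w N D S \<and> j = N T - D T"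
  then obtain N' D' S'
    where st': "state_trajectory T p r A K B \<alpha> N\<^sub>0 D\<^sub>0 S\<^sub>0 u v w N' D' S'" and j: "j = N' T - D' T"
    by blast
  have "N' T = N T" "D' T = D T"
    using assms st' by (simp_all add: antisym state_trajectory_cash_le state_trajectory_debt_le)
  then show "j = N T - D T"
    using j by simp
qed (use st in blast)

section \<open>Piecewise continuity of the candidate controls\<close>

lemma piecewise_continuous_on_const: "piecewise_continuous_on a b (\<lambda>_. c)"
  unfolding piecewise_continuous_on_def by (auto intro!: exI[of _ c])

lemma piecewise_continuous_on_step:
  "piecewise_continuous_on a b (\<lambda>t. if t < s then c else d)"
proof -
  let ?f = "\<lambda>t::real. if t < s then c else d"
  have below: "\<forall>\<^sub>F x in nhds t. ?f x = c" if "t < s" for t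
    by (rule eventually_mono[OF eventually_nhds_in_open[of "{..<s}" t]]) (use that in auto)
  have above: "\<forall>\<^sub>F x in nhds t. ?f x = d" if "t > s" for t
    by (rule eventually_mono[OF eventually_nhds_in_open[of "{s<..}" t]]) (use that in auto)
  have cont: "isCont ?f t" if "t \<noteq> s" for t
  proof (cases "t < s")
    case True
    show ?thesis by (subst isCont_cong[OF below[OF True]]) simp
  next
    case False
    then have "s < t" using that by simp
    show ?thesis by (subst isCont_cong[OF above[OF \<open>s < t\<close>]]) simp
  qed
  have "{t \<in> {a..b}. \<not> continuous (at t within {a..b}) ?f} \<subseteq> {s}"
    using cont by (auto intro: continuous_at_imp_continuous_at_within)
  then have "finite {t \<in> {a..b}. \<not> continuous (at t within {a..b}) ?f}"
    by (rule finite_subset) simp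
  \<comment> \<open>At the jump the value is \<open>d\<close>, so the left limit \<open>c\<close>
    has to be named separately; the right limit is the value of \<open>?f\<close>
    everywhere.\<close>
  moreover have "(?f \<longlongrightarrow> (if t = s then c else ?f t)) (at_left t)" for t
  proof (cases "t = s")
    case True
    have "\<forall>\<^sub>F x in at_left s. ?f x = c"
      by (simp add: eventually_at_filter)
    then show ?thesis using True by (simp only: simp_thms if_True tendsto_eventually)
  next
    case False
    then show ?thesis
      using continuous_at_imp_continuous_at_within[OF cont] by (simp only: continuous_within if_False)
  qed
  moreover have "(?f \<longlongrightarrow> ?f t) (at_right t)" for t
  proof (cases "t = s")
    case True
    have "\<forall>\<^sub>F x in at_right s. ?f x = d"
      by (simp add: eventually_at_filter)
    then show ?thesis using True by (simp only: less_irrefl if_False tendsto_eventually)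
  next
    case False
    then show ?thesis
      using continuous_at_imp_continuous_at_within[OF cont] by (simp only: continuous_within)
  qed
  ultimately show ?thesis
    unfolding piecewise_continuous_on_def by (intro conjI ballI exI) assumption+
qed

section \<open>Comparison of states\<close>

text \<open>The bound is the solution of the stock equation with u = 0 and w = w_max and the same
  initial value. It may become negative; the constraint that stock is nonnegative is combined with
  it later.\<close>

lemma stock_ge_fastest_depletion:
  assumes st: "state_trajectory T p r A K B \<alpha> N\<^sub>0 D\<^sub>0 S\<^sub>0 u v w N D S"
    and "\<alpha> > 0" "t \<in> {0..T}"
    and bounds: "\<And>t. t \<in> {0..T} \<Longrightarrow> 0 \<le> u t \<and> w t \<le> w_max"
  shows "exp (- \<alpha> * t) * (S\<^sub>0 + w_max / \<alpha>) - w_max / \<alpha> \<le> S t"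
proof -
  obtain F where F: "finite F"
    and dS: "\<And>t. t \<in> {0<..<T} - F \<Longrightarrow> (S has_real_derivative u t - w t - \<alpha> * S t) (at t)"
    by (rule state_trajectory_derivatives[OF st]) (erule that; simp)
  \<comment> \<open>Integrating factor times the deviation from the equilibrium
    \<open>- w_max / \<alpha>\<close>; up to a positive factor the derivative is the control slack
    \<open>u t - w t + w_max\<close>.\<close>
  define g where "g t = exp (\<alpha> * t) * (S t + w_max / \<alpha>)" for t
  have "continuous_on {0..T} S"
    using st by (simp add: state_trajectory_def)
  then have contS: "continuous_on {0..t} S"
    using \<open>t \<in> {0..T}\<close> by (auto elim: continuous_on_subset)
  have "g 0 \<le> g t"
  proof (rule increasing_if_derivative_nonneg_off_finite
      [where f = g and F = F and f' = "\<lambda>t. exp (\<alpha> * t) * (u t - w t + w_max)"])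
    show "continuous_on {0..t} g"
      unfolding g_def using contS by (auto intro!: continuous_intros)
    show "(g has_real_derivative exp (\<alpha> * x) * (u x - w x + w_max)) (at x)"
      if "x \<in> {0<..<t} - F" for x
      unfolding g_def using that \<open>\<alpha> > 0\<close> \<open>t \<in> {0..T}\<close>
      by (auto intro!: derivative_eq_intros dS simp: algebra_simps)
    show "0 \<le> exp (\<alpha> * x) * (u x - w x + w_max)" if "x \<in> {0<..<t} - F" for x
      using bounds[of x] that \<open>t \<in> {0..T}\<close> by simp
  qed (use F \<open>t \<in> {0..T}\<close> in auto)
  moreover have "g 0 = S\<^sub>0 + w_max / \<alpha>"
    using st by (simp add: g_def state_trajectory_def)
  ultimately have "exp (- \<alpha> * t) * (S\<^sub>0 + w_max / \<alpha>) \<le> exp (- \<alpha> * t) * g t"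
    by simp
  also have "\<dots> = S t + w_max / \<alpha>"
    by (simp add: g_def exp_minus)
  finally show ?thesis by simp
qed

text \<open>Repayments cancel in \<open>N - D\<close>, and \<open>u\<close> lowers the rate of
  \<open>N - D\<close> by \<open>(K + A) * u\<close>, which the weight \<open>K + A\<close> on the
  stock compensates. Hence \<open>u'\<close> and \<open>v'\<close> may be arbitrary, and only the
  sales of the reference trajectory are fixed at their maximum.\<close>

lemma terminal_value_le_of_stock_ge:
  assumes "0 \<le> T" "0 \<le> r" "0 \<le> \<alpha>" "0 \<le> K + A" "K + A \<le> p"
    and st: "state_trajectory T p r A K B \<alpha> N\<^sub>0 D\<^sub>0 S\<^sub>0 u v w N D S"
    and st': "state_trajectory T p r A K B \<alpha> N\<^sub>0 D\<^sub>0 S\<^sub>0 u' v' (\<lambda>_. w_max) N' D' S'"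
    and D: "\<And>t. t \<in> {0..T} \<Longrightarrow> D' t \<le> D t"
    and S: "\<And>t. t \<in> {0..T} \<Longrightarrow> S' t \<le> S t"
    and w: "\<And>t. t \<in> {0..T} \<Longrightarrow> w t \<le> w_max"
  shows "N T - D T \<le> N' T - D' T + (K + A) * (S' T - S T)"
proof -
  obtain F where F: "finite F"
    and d: "\<And>t. t \<in> {0<..<T} - F \<Longrightarrow> (N has_real_derivative p * w t - v t - K * u t - B) (at t)"
      "\<And>t. t \<in> {0<..<T} - F \<Longrightarrow> (D has_real_derivative r * D t + A * u t - v t) (at t)"
      "\<And>t. t \<in> {0<..<T} - F \<Longrightarrow> (S has_real_derivative u t - w t - \<alpha> * S t) (at t)"
    by (rule state_trajectory_derivatives[OF st]) (erule that; simp)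
  obtain F' where F': "finite F'"
    and d': "\<And>t. t \<in> {0<..<T} - F' \<Longrightarrow> (N' has_real_derivative p * w_max - v' t - K * u' t - B) (at t)"
      "\<And>t. t \<in> {0<..<T} - F' \<Longrightarrow> (D' has_real_derivative r * D' t + A * u' t - v' t) (at t)"
      "\<And>t. t \<in> {0<..<T} - F' \<Longrightarrow> (S' has_real_derivative u' t - w_max - \<alpha> * S' t) (at t)"
    by (rule state_trajectory_derivatives[OF st']) (erule that; simp)
  define g where "g t = (N' t - D' t) - (N t - D t) + (K + A) * (S' t - S t)" for t
  \<comment> \<open>The derivative of \<open>g\<close>, grouped into three terms that are
    nonnegative separately: sales below the maximal rate, interest on excess debt, decay of excess
    stock.\<close>
  define g' where
    "g' t = (p - K - A) * (w_max - w t) + r * (D t - D' t) + (K + A) * (\<alpha> * (S t - S' t))" for t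
  have "g 0 \<le> g T"
  proof (rule increasing_if_derivative_nonneg_off_finite[where f = g and F = "F \<union> F'" and f' = g'])
    show "continuous_on {0..T} g"
      unfolding g_def using st st' by (auto simp: state_trajectory_def intro!: continuous_intros)
    show "(g has_real_derivative g' t) (at t)" if "t \<in> {0<..<T} - (F \<union> F')" for t
      unfolding g_def g'_def using that
      by (auto intro!: derivative_eq_intros d d' simp: algebra_simps)
    show "0 \<le> g' t" if "t \<in> {0<..<T} - (F \<union> F')" for t
    proof -
      have "0 \<le> (p - K - A) * (w_max - w t)"
        using that w[of t] \<open>K + A \<le> p\<close> by simp
      moreover have "0 \<le> r * (D t - D' t)"
        using that D[of t] \<open>0 \<le> r\<close> by simp
      moreover have "0 \<le> (K + A) * (\<alpha> * (S t - S' t))"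
        using that S[of t] \<open>0 \<le> \<alpha>\<close> \<open>0 \<le> K + A\<close> by simp
      ultimately show ?thesis
        by (simp add: g'_def)
    qed
  qed (use F F' \<open>0 \<le> T\<close> in auto)
  moreover have "g 0 = 0"
    using st st' by (simp add: g_def state_trajectory_def)
  ultimately show ?thesis
    by (simp add: g_def)
qed

theorem mainTheorem4:
  fixes T p r A K B \<alpha> u_max v_max w_max S_max N\<^sub>0 D\<^sub>0 S\<^sub>0 t\<^sub>S :: real
    and u_opt v_opt w_opt :: "real \<Rightarrow> real"
  assumes "T > 0" "p > 0" "r > 0" "A > 0" "K > 0" "B > 0" "\<alpha> > 0"
    and "u_max > 0" "v_max > 0" "w_max > 0" "S_max > 0"
    and "w_max \<le> u_max"
    and "v_max \<ge> A * w_max"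
    and "(p - A - K) * w_max > B"
    and "N\<^sub>0 > 0" "D\<^sub>0 > 0" "N\<^sub>0 \<ge> D\<^sub>0"
    and "0 < S\<^sub>0" "S\<^sub>0 \<le> S_max"
    and "t\<^sub>S = 1 / \<alpha> * ln ((\<alpha> * S\<^sub>0 + w_max) / w_max)"
    and "t\<^sub>S < T"
    and "u_opt = (\<lambda>t. if t < t\<^sub>S then 0 else w_max)"
    and "v_opt = (\<lambda>t. if t < t\<^sub>S then 0 else A * w_max)"
    and "w_opt = (\<lambda>t. w_max)"
  shows "optimal_control T p r A K B \<alpha> u_max v_max w_max S_max (N\<^sub>0 - D\<^sub>0) 0 S\<^sub>0 u_opt v_opt w_opt \<and>
         objective T p r A K B \<alpha> (N\<^sub>0 - D\<^sub>0) 0 S\<^sub>0 u_opt v_opt w_opt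
           = N\<^sub>0 - D\<^sub>0 + (p * w_max - B) * T + (A + K) * w_max * (t\<^sub>S - T) \<and>
         N\<^sub>0 - D\<^sub>0 + (p * w_max - B) * T + (A + K) * w_max * (t\<^sub>S - T) > 0"
proof -
  note pos = assms(1-11) and u_opt = assms(22) and v_opt = assms(23) and w_opt = assms(24)

  \<comment> \<open>The switching time and the candidate trajectory\<close>
  have exp_tS: "exp (\<alpha> * t\<^sub>S) = (\<alpha> * S\<^sub>0 + w_max) / w_max"
    using pos \<open>0 < S\<^sub>0\<close> by (simp add: assms(20) add_pos_pos)
  have tS_pos: "0 < t\<^sub>S"
    using pos \<open>0 < S\<^sub>0\<close> by (simp add: assms(20) add_pos_pos)
  have "\<alpha> * S\<^sub>0 + w_max \<noteq> 0"
    using pos \<open>0 < S\<^sub>0\<close> add_pos_pos[of "\<alpha> * S\<^sub>0" w_max] by simp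
  \<comment> \<open>Depletion at full sales without purchases, continued past its zero
    \<open>t\<^sub>S\<close>; the same expression as in
    \<open>stock_ge_fastest_depletion\<close>.\<close>
  define Sd where "Sd t = exp (- \<alpha> * t) * (S\<^sub>0 + w_max / \<alpha>) - w_max / \<alpha>" for t
  have Sd_tS: "Sd t\<^sub>S = 0"
    using pos \<open>\<alpha> * S\<^sub>0 + w_max \<noteq> 0\<close> by (simp add: Sd_def exp_minus exp_tS divide_simps)
  have Sd_0: "Sd 0 = S\<^sub>0"
    by (simp add: Sd_def)
  have Sd_antimono: "Sd t \<le> Sd s" if "s \<le> t" for s t
    using that pos \<open>0 < S\<^sub>0\<close> by (auto simp: Sd_def intro!: mult_right_mono)
  \<comment> \<open>Production starts at \<open>t\<^sub>S\<close>. From then on it costs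
    \<open>K * w_max\<close> per unit time directly and \<open>A * w_max\<close> through immediate
    repayment of the new debt.\<close>
  define Nopt where "Nopt t = N\<^sub>0 - D\<^sub>0 + (p * w_max - B) * t - (A + K) * w_max * max 0 (t - t\<^sub>S)" for t
  \<comment> \<open>After \<open>t\<^sub>S\<close> purchases equal sales and the stock stays at 0.
    The form with \<open>max\<close> makes continuity immediate and matches the two lower bounds on
    an admissible stock.\<close>
  define Sopt where "Sopt t = max 0 (Sd t)" for t
  have S_before: "Sopt t = Sd t" if "t \<le> t\<^sub>S" for t
    using Sd_antimono[OF that] Sd_tS by (simp add: Sopt_def)
  have S_after: "Sopt t = 0" if "t\<^sub>S \<le> t" for t
    using Sd_antimono[OF that] Sd_tS by (simp add: Sopt_def)
  \<comment> \<open>Since \<open>v_opt\<close> equals \<open>A * u_opt\<close> at all times, the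
    debt remains 0. The jump of the controls at \<open>t\<^sub>S\<close> is the single exceptional
    time.\<close>
  have st: "state_trajectory T p r A K B \<alpha> (N\<^sub>0 - D\<^sub>0) 0 S\<^sub>0 u_opt v_opt w_opt Nopt (\<lambda>_. 0) Sopt"
    unfolding state_trajectory_def
  proof (intro conjI exI[of _ "{t\<^sub>S}"] ballI)
    show "continuous_on {0..T} Nopt"
      unfolding Nopt_def by (intro continuous_intros)
    show "continuous_on {0..T} Sopt"
      unfolding Sopt_def Sd_def by (intro continuous_intros)
    show "Nopt 0 = N\<^sub>0 - D\<^sub>0"
      using tS_pos by (simp add: Nopt_def)
    show "Sopt 0 = S\<^sub>0"
      using Sd_0 \<open>0 < S\<^sub>0\<close> by (simp add: Sopt_def)
    fix t assume t: "t \<in> {0..T} - {t\<^sub>S}"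
    show "((\<lambda>_. 0) has_real_derivative r * 0 + A * u_opt t - v_opt t) (at t within {0..T})"
      by (simp add: u_opt v_opt)
    \<comment> \<open>On each open side of \<open>t\<^sub>S\<close> both \<open>max\<close>
      expressions reduce to smooth formulas, whose derivatives transfer locally.\<close>
    consider "t < t\<^sub>S" | "t\<^sub>S < t"
      using t by fastforce
    then have "(Nopt has_real_derivative p * w_opt t - v_opt t - K * u_opt t - B) (at t) \<and>
               (Sopt has_real_derivative u_opt t - w_opt t - \<alpha> * Sopt t) (at t)"
    proof cases
      case 1
      have "((\<lambda>t. N\<^sub>0 - D\<^sub>0 + (p * w_max - B) * t)
              has_real_derivative p * w_opt t - v_opt t - K * u_opt t - B) (at t)"
        using 1 by (auto intro!: derivative_eq_intros simp: u_opt v_opt w_opt)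
      moreover have "(Sd has_real_derivative u_opt t - w_opt t - \<alpha> * Sopt t) (at t)"
        using 1 pos unfolding S_before[OF less_imp_le[OF 1]]
        by (auto intro!: derivative_eq_intros simp: Sd_def[abs_def] u_opt w_opt algebra_simps)
      ultimately show ?thesis
        using 1 S_before
        by (auto elim!: has_field_derivative_transform_within_open[where S = "{..<t\<^sub>S}"] simp: Nopt_def)
    next
      case 2
      have "((\<lambda>t. N\<^sub>0 - D\<^sub>0 + (p * w_max - B) * t - (A + K) * w_max * (t - t\<^sub>S))
              has_real_derivative p * w_opt t - v_opt t - K * u_opt t - B) (at t)"
        using 2 by (auto intro!: derivative_eq_intros simp: u_opt v_opt w_opt algebra_simps)
      moreover have "((\<lambda>_. 0) has_real_derivative u_opt t - w_opt t - \<alpha> * Sopt t) (at t)"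
        using 2 S_after by (simp add: u_opt w_opt)
      ultimately show ?thesis
        using 2 S_after
        by (auto elim!: has_field_derivative_transform_within_open[where S = "{t\<^sub>S<..}"] simp: Nopt_def)
    qed
    then show "(Nopt has_real_derivative p * w_opt t - v_opt t - K * u_opt t - B) (at t within {0..T})"
      "(Sopt has_real_derivative u_opt t - w_opt t - \<alpha> * Sopt t) (at t within {0..T})"
      by (auto intro: has_field_derivative_at_within)
  qed auto
  have profit: "(A + K) * w_max < p * w_max - B"
    using assms(14) by (simp add: algebra_simps)
  \<comment> \<open>Profit outweighs the production cost accrued over all of \<open>[0, t]\<close>,
    while that cost is paid only after \<open>t\<^sub>S\<close>; the saving over
    \<open>min t t\<^sub>S\<close> remains. It gives the cash constraint and also strict positivity
    at \<open>T\<close>, even when \<open>N\<^sub>0 = D\<^sub>0\<close>.\<close>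
  have N_ge: "(A + K) * w_max * min t t\<^sub>S \<le> Nopt t" if "0 \<le> t" for t
  proof -
    have "(A + K) * w_max * t \<le> (p * w_max - B) * t"
      using profit that by (intro mult_right_mono) auto
    moreover have "t = min t t\<^sub>S + max 0 (t - t\<^sub>S)"
      by auto
    ultimately show ?thesis
      using \<open>D\<^sub>0 \<le> N\<^sub>0\<close> unfolding Nopt_def by (smt (verit) distrib_left)
  qed

  \<comment> \<open>Admissibility and value of the candidate\<close>
  have adm: "admissible_control T p r A K B \<alpha> u_max v_max w_max S_max (N\<^sub>0 - D\<^sub>0) 0 S\<^sub>0 u_opt v_opt w_opt"
    unfolding admissible_control_def
  proof (intro conjI ballI)
    show "piecewise_continuous_on 0 T u_opt" "piecewise_continuous_on 0 T v_opt"
      unfolding u_opt v_opt by (rule piecewise_continuous_on_step)+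
    show "piecewise_continuous_on 0 T w_opt"
      unfolding w_opt by (rule piecewise_continuous_on_const)
    have "Nopt t \<ge> 0 \<and> 0 \<le> Sopt t \<and> Sopt t \<le> S_max" if "t \<in> {0..T}" for t
    proof -
      have "0 \<le> (A + K) * w_max * min t t\<^sub>S"
        using that pos tS_pos by simp
      moreover have "Sd t \<le> S_max"
        using Sd_antimono[of 0 t] Sd_0 that assms(19) by simp
      ultimately show ?thesis
        using N_ge[of t] that pos by (simp add: Sopt_def)
    qed
    then show "\<exists>N D S. state_trajectory T p r A K B \<alpha> (N\<^sub>0 - D\<^sub>0) 0 S\<^sub>0 u_opt v_opt w_opt N D S \<and>
        (\<forall>t \<in> {0..T}. N t \<ge> 0 \<and> D t \<ge> 0 \<and> 0 \<le> S t \<and> S t \<le> S_max)"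
      by (intro exI[of _ "Nopt"] exI[of _ "\<lambda>_. 0"] exI[of _ "Sopt"] conjI[OF st]) simp
  qed (use pos assms(12,13) in \<open>auto simp: u_opt v_opt w_opt\<close>)
  have obj: "objective T p r A K B \<alpha> (N\<^sub>0 - D\<^sub>0) 0 S\<^sub>0 u_opt v_opt w_opt = Nopt T"
    using objective_eq[OF _ st] pos by simp
  have N_T: "Nopt T = N\<^sub>0 - D\<^sub>0 + (p * w_max - B) * T + (A + K) * w_max * (t\<^sub>S - T)"
    using \<open>t\<^sub>S < T\<close> by (simp add: Nopt_def algebra_simps)
  have "0 < (A + K) * w_max * min T t\<^sub>S"
    using pos tS_pos by simp
  then have N_T_pos: "0 < Nopt T"
    using N_ge[of T] pos by simp

  \<comment> \<open>Optimality against every admissible control\<close>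
  have "objective T p r A K B \<alpha> (N\<^sub>0 - D\<^sub>0) 0 S\<^sub>0 u v w \<le> Nopt T"
    if admissible: "admissible_control T p r A K B \<alpha> u_max v_max w_max S_max (N\<^sub>0 - D\<^sub>0) 0 S\<^sub>0 u v w"
    for u v w
  proof -
    obtain N D S where st': "state_trajectory T p r A K B \<alpha> (N\<^sub>0 - D\<^sub>0) 0 S\<^sub>0 u v w N D S"
      and state: "\<And>t. t \<in> {0..T} \<Longrightarrow> D t \<ge> 0 \<and> 0 \<le> S t"
      using admissible unfolding admissible_control_def by blast
    have control: "0 \<le> u t \<and> w t \<le> w_max" if "t \<in> {0..T}" for t
      using admissible that unfolding admissible_control_def by blast
    \<comment> \<open>The depletion bound and the state constraint \<open>0 \<le> S t\<close>
      together bound the \<open>max\<close> in \<open>Sopt\<close>.\<close>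
    have S_le: "Sopt t \<le> S t" if "t \<in> {0..T}" for t
      using stock_ge_fastest_depletion[OF st' \<open>\<alpha> > 0\<close> that control] state[OF that]
      by (simp add: Sopt_def Sd_def)
    have "0 < (p - A - K) * w_max"
      using assms(14) pos by linarith
    then have "K + A \<le> p"
      using pos by (simp add: zero_less_mult_iff)
    \<comment> \<open>The reference debt is 0, so the required debt comparison is exactly the state
      constraint \<open>D t \<ge> 0\<close>.\<close>
    then have "N T - D T \<le> Nopt T - 0 + (K + A) * (Sopt T - S T)"
      using pos state control S_le
      by (intro terminal_value_le_of_stock_ge[OF _ _ _ _ _ st' st[unfolded w_opt]]) auto
    also have "\<dots> \<le> Nopt T"
      using pos S_le[of T] by (simp add: mult_nonneg_nonpos)
    finally show ?thesis
      using objective_eq[OF _ st'] pos by simp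
  qed
  then show ?thesis
    using adm obj N_T N_T_pos unfolding optimal_control_def by simp
qed

end
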